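(* For all $p,q\in(1,\infty)$ and $x\in(0,1)$, with $p^*=p/(p-1)$, $$F\!\left(\frac1q,\frac1p-1;1+\frac1q;x\right)=\frac{q\,\sin_{p,q}^{-1}(x^{1/q})+p^*x^{1/q}(1-x)^{1/p^*}}{(p^*+q)\,x^{1/q}},$$ $$F\!\left(1+\frac1q,\frac1p;2+\frac1q;x\right)=\frac{p^*(q+1)\left(\sin_{p,q}^{-1}(x^{1/q})-x^{1/q}(1-x)^{1/p^*}\right)}{(p^*+q)\,x^{1+1/q}}.$$
   Context: For $p,q\in(1,\infty)$, $\sin_{p,q}^{-1}x:=\int_0^x(1-t^q)^{-1/p}\,dt$ for $0\le x\le1$. For $a,b\in\mathbb{R}$ and $c\ne 0,-1,-2,\dots$, the Gaussian hypergeometric function is $F(a,b;c;x):=\sum_{n=0}^\infty\frac{(a)_n(b)_n}{(c)_n}\frac{x^n}{n!}$ for $|x|<1$, where $(a)_0:=1$ and $(a)_n:=a(a+1)\cdots(a+n-1)$ for $n\ge1$. *)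

theory Defs
  imports "HOL-Analysis.Analysis"
begin

text \<open>
  For \<open>x = 1\<close> the integrand is unbounded at the right endpoint, where \<open>0 powr (- 1 / p) = 0\<close>;
  the value at this single point does not affect the (gauge) integral, which also covers the
  improper case. Meaningful for \<open>p, q > 1\<close> and \<open>0 \<le> x \<le> 1\<close>.
\<close>

definition arcsin_pq :: "real \<Rightarrow> real \<Rightarrow> real \<Rightarrow> real" where
  "arcsin_pq p q x = integral {0..x} (\<lambda>t. (1 - t powr q) powr (- 1 / p))"

text \<open>Meaningful for \<open>c\<close> not a nonpositive integer and \<open>\<bar>x\<bar> < 1\<close>.\<close>

definition hypergeo_2F1 :: "real \<Rightarrow> real \<Rightarrow> real \<Rightarrow> real \<Rightarrow> real" where
  "hypergeo_2F1 a b c x =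
     (\<Sum>n. pochhammer a n * pochhammer b n / pochhammer c n * (x ^ n / fact n))"

definition conj_exponent :: "real \<Rightarrow> real" where
  "conj_exponent p = p / (p - 1)"

end

theory Submission
  imports Defs
begin

text \<open>
  Let \<open>s > 0\<close>. When the lower parameter of a Gaussian function exceeds the upper parameter \<open>s\<close> by
  one, the quotient \<open>(s)\<^sub>n / (1 + s)\<^sub>n\<close> collapses to \<open>s / (s + n)\<close>. The operator
  \<open>f \<mapsto> s f + x f'\<close> multiplies the \<open>n\<close>-th coefficient of a power series by \<open>s + n\<close>, so it turns
  \<open>F(s, b; 1 + s; x)\<close> into \<open>s\<close> times the binomial series of \<open>(1 - x)\<^bsup>-b\<^esup>\<close>. In other words,
  \<open>x\<^bsup>s\<^esup> F(s, b; 1 + s; x)\<close> is an antiderivative of \<open>s x\<^bsup>s-1\<^esup> (1 - x)\<^bsup>-b\<^esup>\<close>, and it vanishes at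
  \<open>0\<close> (lemmas \<open>has_real_derivative_powr_times_hypergeo_2F1\<close> and
  \<open>continuous_on_powr_times_hypergeo_2F1\<close>).

  Both functions of the theorem have this shape, with \<open>b = 1/p - 1\<close> for the exponent \<open>1/q\<close> and with
  \<open>b = 1/p\<close> for the exponent \<open>1 + 1/q\<close>. After the denominators are cleared, the right-hand sides are
  combinations of \<open>arcsin_pq p q (x\<^bsup>1/q\<^esup>)\<close> and \<open>x\<^bsup>1/q\<^esup> (1 - x)\<^bsup>1/p*\<^esup>\<close>. These vanish at \<open>0\<close> as
  well, and since \<open>1/p* = 1 - 1/p\<close>, all derivatives involved are products of
  \<open>x\<^bsup>1/q-1\<^esup> (1 - x)\<^bsup>-1/p\<^esup>\<close> with a polynomial of degree at most one in \<open>x\<close>. Each identity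
  therefore reduces to an identity between two such polynomials.
\<close>

section \<open>Gaussian functions with shifted parameter as incomplete beta integrals\<close>

lemma pochhammer_ratio_shift:
  fixes s :: real
  assumes "s > 0"
  shows "pochhammer s n / pochhammer (1 + s) n = s / (s + real n)"
proof -
  have "s * pochhammer (1 + s) n = pochhammer s n * (s + real n)"
    using pochhammer_rec[of s n] pochhammer_Suc[of s n] by (simp add: add.commute)
  moreover have "pochhammer (1 + s) n > 0"
    using assms by (intro pochhammer_pos) auto
  ultimately show ?thesis
    using assms by (simp add: field_simps)
qed

lemma pochhammer_series_sums:
  fixes b x :: real
  assumes "\<bar>x\<bar> < 1"
  shows "(\<lambda>n. pochhammer b n / fact n * x ^ n) sums (1 - x) powr (- b)"
proof -
  have "(- b gchoose n) * (- x) ^ n = pochhammer b n / fact n * x ^ n" for n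
  proof -
    have "(- 1) ^ n * (- x) ^ n = x ^ n"
      by (simp flip: power_mult_distrib)
    then show ?thesis
      by (simp add: gbinomial_pochhammer)
  qed
  moreover have "(\<lambda>n. (- b gchoose n) * (- x) ^ n) sums (1 + (- x)) powr (- b)"
    using assms by (intro gen_binomial_real) auto
  ultimately show ?thesis
    by simp
qed

lemma hypergeo_2F1_shift_series:
  assumes "s > 0"
  shows "hypergeo_2F1 s b (1 + s) x = (\<Sum>n. s / (s + real n) * (pochhammer b n / fact n) * x ^ n)"
proof -
  have "pochhammer s n * pochhammer b n / pochhammer (1 + s) n * (x ^ n / fact n) =
        pochhammer s n / pochhammer (1 + s) n * (pochhammer b n / fact n) * x ^ n" for n
    by simp
  then show ?thesis
    unfolding hypergeo_2F1_def pochhammer_ratio_shift[OF assms] by simp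
qed

text \<open>
  The factor \<open>s / (s + n)\<close> lies in the unit interval, so comparison with the binomial series applies.
  The latter converges absolutely at \<open>x\<close> because it converges at some \<open>r\<close> with \<open>\<bar>x\<bar> < r < 1\<close>.
\<close>

lemma summable_hypergeo_2F1_shift:
  fixes s b x :: real
  assumes "s > 0" and "\<bar>x\<bar> < 1"
  shows "summable (\<lambda>n. s / (s + real n) * (pochhammer b n / fact n) * x ^ n)"
proof (rule summable_comparison_test')
  obtain r where r: "\<bar>x\<bar> < r" "r < 1"
    using dense assms(2) by blast
  then have "summable (\<lambda>n. pochhammer b n / fact n * r ^ n)"
    using pochhammer_series_sums[of r b] by (auto simp: sums_iff)
  then show "summable (\<lambda>n. norm (pochhammer b n / fact n * x ^ n))"
    by (rule powser_insidea) (use r in auto)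
next
  fix n :: nat
  have "norm (s / (s + real n)) \<le> 1"
    using assms(1) by simp
  then have "norm (s / (s + real n)) * norm (pochhammer b n / fact n * x ^ n)
               \<le> 1 * norm (pochhammer b n / fact n * x ^ n)"
    by (intro mult_right_mono) auto
  then show "norm (s / (s + real n) * (pochhammer b n / fact n) * x ^ n)
               \<le> norm (pochhammer b n / fact n * x ^ n)"
    unfolding norm_mult mult.assoc by simp
qed

text \<open>
  In \<open>s f + x f'\<close> the \<open>n\<close>-th coefficient of \<open>f\<close> acquires the factor \<open>s + n\<close>. This cancels the
  denominator in \<open>s / (s + n)\<close> and leaves a binomial series, which has a closed form.
\<close>

lemma hypergeo_2F1_shift_deriv:
  fixes s b x :: real
  assumes "s > 0" and "\<bar>x\<bar> < 1"
  obtains f' where "(hypergeo_2F1 s b (1 + s) has_real_derivative f') (at x)"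
    and "s * hypergeo_2F1 s b (1 + s) x + x * f' = s * (1 - x) powr (- b)"
proof
  define c where "c = (\<lambda>n. s / (s + real n) * (pochhammer b n / fact n))"
  let ?f' = "\<Sum>n. diffs c n * x ^ n"
  have F: "hypergeo_2F1 s b (1 + s) = (\<lambda>x. \<Sum>n. c n * x ^ n)"
    using hypergeo_2F1_shift_series[OF assms(1)] by (auto simp: c_def)
  have summable: "summable (\<lambda>n. c n * y ^ n)" if "norm y < 1" for y
    using summable_hypergeo_2F1_shift[OF assms(1)] that by (auto simp: c_def)
  show "(hypergeo_2F1 s b (1 + s) has_real_derivative ?f') (at x)"
    unfolding F by (rule termdiffs_strong'[OF summable]) (use assms in auto)
  have "(\<lambda>n. real n * c n * x ^ (n - Suc 0)) sums ?f'"
    by (rule diffs_equiv, rule termdiff_converges[where K = 1]) (use assms summable in auto)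
  then have "(\<lambda>n. x * (real n * c n * x ^ (n - Suc 0))) sums (x * ?f')"
    by (rule sums_mult)
  moreover have "x * (real n * c n * x ^ (n - Suc 0)) = real n * c n * x ^ n" for n
    by (cases n) auto
  ultimately have "(\<lambda>n. real n * c n * x ^ n) sums (x * ?f')"
    by simp
  moreover have "(\<lambda>n. s * (c n * x ^ n)) sums (s * (\<Sum>n. c n * x ^ n))"
    using summable assms(2) by (intro sums_mult summable_sums) auto
  ultimately have "(\<lambda>n. s * (c n * x ^ n) + real n * c n * x ^ n)
                     sums (s * (\<Sum>n. c n * x ^ n) + x * ?f')"
    by (intro sums_add)
  moreover have "s * (c n * x ^ n) + real n * c n * x ^ n = s * (pochhammer b n / fact n * x ^ n)" for n
  proof -
    have "s * (c n * x ^ n) + real n * c n * x ^ n = (s + real n) * c n * x ^ n"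
      by (simp add: algebra_simps)
    also have "(s + real n) * c n = s * (pochhammer b n / fact n)"
      using assms(1) by (simp add: c_def add_nonneg_eq_0_iff)
    finally show ?thesis
      by simp
  qed
  ultimately have "(\<lambda>n. s * (pochhammer b n / fact n * x ^ n))
                     sums (s * (\<Sum>n. c n * x ^ n) + x * ?f')"
    by simp
  moreover have "(\<lambda>n. s * (pochhammer b n / fact n * x ^ n)) sums (s * (1 - x) powr (- b))"
    using assms(2) by (intro sums_mult pochhammer_series_sums)
  ultimately show "s * hypergeo_2F1 s b (1 + s) x + x * ?f' = s * (1 - x) powr (- b)"
    unfolding F by (rule sums_unique2)
qed

lemma has_real_derivative_powr_times_hypergeo_2F1:
  assumes "s > 0" and "0 < x" and "x < 1"
  shows "((\<lambda>x. x powr s * hypergeo_2F1 s b (1 + s) x) has_real_derivative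
            s * x powr (s - 1) * (1 - x) powr (- b)) (at x)"
proof -
  obtain f' where f': "(hypergeo_2F1 s b (1 + s) has_real_derivative f') (at x)"
    and ode: "s * hypergeo_2F1 s b (1 + s) x + x * f' = s * (1 - x) powr (- b)"
    using hypergeo_2F1_shift_deriv[of s x b] assms by auto
  have "((\<lambda>x. x powr s * hypergeo_2F1 s b (1 + s) x) has_real_derivative
            x powr s * f' + s * x powr (s - 1) * hypergeo_2F1 s b (1 + s) x) (at x)"
    by (rule DERIV_mult'[OF has_real_derivative_powr f']) (use assms in auto)
  moreover have "x powr s * f' + s * x powr (s - 1) * hypergeo_2F1 s b (1 + s) x =
      x powr (s - 1) * (s * hypergeo_2F1 s b (1 + s) x + x * f')"
  proof -
    have "x powr s = x * x powr (s - 1)"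
      using assms by (simp add: powr_diff)
    then show ?thesis
      by (simp add: algebra_simps)
  qed
  ultimately show ?thesis
    unfolding ode by (simp add: mult_ac)
qed

lemma continuous_on_powr_times_hypergeo_2F1:
  assumes "s > 0" and "x < 1"
  shows "continuous_on {0..x} (\<lambda>x. x powr s * hypergeo_2F1 s b (1 + s) x)"
proof (intro continuous_on_mult continuous_on_powr' continuous_intros)
  have "isCont (hypergeo_2F1 s b (1 + s)) y" if "y \<in> {0..x}" for y
  proof -
    have "\<bar>y\<bar> < 1"
      using that assms(2) by simp
    then obtain f' where "(hypergeo_2F1 s b (1 + s) has_real_derivative f') (at y)"
      using hypergeo_2F1_shift_deriv[OF assms(1)] by blast
    then show ?thesis
      by (rule DERIV_isCont)
  qed
  then show "continuous_on {0..x} (hypergeo_2F1 s b (1 + s))"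
    by (simp add: continuous_at_imp_continuous_on)
qed (use assms in auto)

section \<open>The inverse generalized sine and its algebraic companion\<close>

lemma powr_less_one_nonneg:
  fixes t q :: real
  assumes "0 \<le> t" and "t < 1" and "q > 0"
  shows "t powr q < 1"
  using powr_less_mono2[of q t 1] assms by simp

lemma continuous_on_arcsin_pq_integrand:
  fixes q r a :: real
  assumes "q > 0" and "r < 1"
  shows "continuous_on {0..r} (\<lambda>t. (1 - t powr q) powr a)"
proof (rule continuous_on_powr)
  show "continuous_on {0..r} (\<lambda>t. 1 - t powr q)"
    using assms(1) by (intro continuous_on_diff continuous_on_powr' continuous_intros) auto
  show "\<forall>t\<in>{0..r}. 1 - t powr q \<noteq> 0"
  proof
    fix t assume "t \<in> {0..r}"
    then have "t powr q < 1"
      using assms by (intro powr_less_one_nonneg) auto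
    then show "1 - t powr q \<noteq> 0"
      by simp
  qed
qed (rule continuous_on_const)

text \<open>
  In the variable \<open>x\<close> with \<open>t = x\<^bsup>1/q\<^esup>\<close> the inverse generalized sine belongs to the same family
  of incomplete beta integrals as the functions above.
\<close>

lemma has_real_derivative_arcsin_pq_powr:
  assumes "q > 0" and "0 < x" and "x < 1"
  shows "((\<lambda>x. arcsin_pq p q (x powr (1 / q))) has_real_derivative
            1 / q * x powr (1 / q - 1) * (1 - x) powr (- 1 / p)) (at x)"
proof -
  let ?g = "\<lambda>t. (1 - t powr q) powr (- 1 / p)"
  define u where "u = x powr (1 / q)"
  have u: "0 < u" "u < 1" "u powr q = x"
    using assms powr_less_one_nonneg[of x "1 / q"] by (auto simp: u_def powr_powr)
  \<comment> \<open>The integrand need not be continuous at \<open>1\<close>, so the interval has to end strictly between \<open>u\<close> and \<open>1\<close>.\<close>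
  obtain r where r: "u < r" "r < 1"
    using dense u by blast
  have "(arcsin_pq p q has_real_derivative ?g u) (at u within {0..r})"
    unfolding arcsin_pq_def
    using r u assms by (intro integral_has_real_derivative continuous_on_arcsin_pq_integrand) auto
  then have "(arcsin_pq p q has_real_derivative ?g u) (at u)"
    using r u at_within_Icc_at[of 0 u r] by simp
  then have "((\<lambda>x. arcsin_pq p q (x powr (1 / q))) has_real_derivative
                ?g u * (1 / q * x powr (1 / q - 1))) (at x)"
    unfolding u_def by (rule DERIV_chain2[OF _ has_real_derivative_powr[OF assms(2)]])
  then show ?thesis
    by (simp add: u mult_ac)
qed

lemma continuous_on_arcsin_pq_powr:
  assumes "q > 0" and "0 \<le> x" and "x < 1"
  shows "continuous_on {0..x} (\<lambda>x. arcsin_pq p q (x powr (1 / q)))"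
proof (rule continuous_on_compose2[of "{0..x powr (1 / q)}" "arcsin_pq p q"])
  have "x powr (1 / q) < 1"
    using assms by (intro powr_less_one_nonneg) auto
  then show "continuous_on {0..x powr (1 / q)} (arcsin_pq p q)"
    unfolding arcsin_pq_def using assms
    by (intro indefinite_integral_continuous_1 integrable_continuous_real
          continuous_on_arcsin_pq_integrand) auto
  show "continuous_on {0..x} (\<lambda>x. x powr (1 / q))"
    using assms by (intro continuous_on_powr' continuous_intros) auto
  show "(\<lambda>x. x powr (1 / q)) ` {0..x} \<subseteq> {0..x powr (1 / q)}"
    using assms(1) by (auto intro!: powr_mono2)
qed

lemma has_real_derivative_powr_times_one_minus_powr:
  fixes s a x :: real
  assumes "0 < x" and "x < 1"
  shows "((\<lambda>x. x powr s * (1 - x) powr a) has_real_derivative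
            (s * (1 - x) - a * x) * x powr (s - 1) * (1 - x) powr (a - 1)) (at x)"
proof -
  have "((\<lambda>x. (1 - x) powr a) has_real_derivative a * (1 - x) powr (a - 1) * (- 1)) (at x)"
    by (rule DERIV_chain2[OF has_real_derivative_powr])
       (use assms in \<open>auto intro!: derivative_eq_intros\<close>)
  then have "((\<lambda>x. x powr s * (1 - x) powr a) has_real_derivative
      x powr s * (a * (1 - x) powr (a - 1) * (- 1)) + s * x powr (s - 1) * (1 - x) powr a) (at x)"
    by (rule DERIV_mult'[OF has_real_derivative_powr[OF assms(1)]])
  moreover have "x powr s = x * x powr (s - 1)" "(1 - x) powr a = (1 - x) * (1 - x) powr (a - 1)"
    using assms by (auto simp: powr_diff)
  ultimately show ?thesis
    by (simp add: algebra_simps)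
qed

lemma continuous_on_powr_times_one_minus_powr:
  fixes s a x :: real
  assumes "s > 0" and "x < 1"
  shows "continuous_on {0..x} (\<lambda>x. x powr s * (1 - x) powr a)"
  by (intro continuous_intros continuous_on_powr') (use assms in auto)

section \<open>Comparison of derivatives\<close>

lemma eq_of_same_derivative_real:
  fixes f g :: "real \<Rightarrow> real"
  assumes "a < b" and "continuous_on {a..b} f" and "continuous_on {a..b} g" and "f a = g a"
    and "\<And>y. a < y \<Longrightarrow> y < b \<Longrightarrow> (f has_real_derivative h y) (at y)"
    and "\<And>y. a < y \<Longrightarrow> y < b \<Longrightarrow> (g has_real_derivative h y) (at y)"
  shows "f b = g b"
proof -
  have "f b - g b = f a - g a"
  proof (rule DERIV_isconst_end[OF assms(1)])
    show "((\<lambda>y. f y - g y) has_real_derivative 0) (at y)" if "a < y" "y < b" for y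
      using DERIV_diff[OF assms(5,6), of y] that by simp
  qed (intro continuous_on_diff assms)
  then show ?thesis
    using assms(4) by simp
qed

lemma arcsin_pq_0 [simp]: "arcsin_pq p q 0 = 0"
  by (simp add: arcsin_pq_def)

text \<open>
  In the next two lemmas \<open>a\<close> stands for \<open>1/p*\<close>, so that \<open>1 / a\<close> is the conjugate exponent. The
  derivative of \<open>x\<^bsup>1/q\<^esup> (1 - x)\<^bsup>a\<^esup>\<close> contains the polynomial \<open>(1 - x)/q - a x\<close>; the coefficients
  \<open>q\<close> and \<open>1 / a\<close> are chosen such that the derivative of the sine, which contributes a constant,
  combines with it to a multiple of \<open>1 - x\<close>.
\<close>

lemma hypergeo_2F1_arcsin_pq_first:
  fixes p q x a :: real
  assumes a: "a = 1 - 1 / p" "a > 0" and q: "q > 0" and x: "0 < x" "x < 1"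
  shows "(1 / a + q) * (x powr (1 / q) * hypergeo_2F1 (1 / q) (- a) (1 + 1 / q) x) =
         q * arcsin_pq p q (x powr (1 / q)) + 1 / a * (x powr (1 / q) * (1 - x) powr a)"
proof (rule eq_of_same_derivative_real[OF x(1)])
  fix y assume "0 < y" "y < x"
  with x have y: "0 < y" "y < 1"
    by auto
  let ?v = "y powr (1 / q - 1)" and ?w = "(1 - y) powr (a - 1)"
  have w: "(1 - y) powr a = (1 - y) * ?w"
    using y by (simp add: powr_diff)
  have exponent: "- 1 / p = a - 1" "- (1 / p) = a - 1"
    using a by simp_all
  show "((\<lambda>x. (1 / a + q) * (x powr (1 / q) * hypergeo_2F1 (1 / q) (- a) (1 + 1 / q) x))
          has_real_derivative (1 / a + q) * (1 / q * ?v * ((1 - y) * ?w))) (at y)"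
    using has_real_derivative_powr_times_hypergeo_2F1[of "1 / q" y "- a"] q y
    by (intro DERIV_cmult) (simp add: w)
  have "((\<lambda>x. q * arcsin_pq p q (x powr (1 / q)) + 1 / a * (x powr (1 / q) * (1 - x) powr a))
          has_real_derivative
          q * (1 / q * ?v * ?w) + 1 / a * ((1 / q * (1 - y) - a * y) * ?v * ?w)) (at y)"
    using has_real_derivative_arcsin_pq_powr[of q y p] q y
    by (intro DERIV_add DERIV_cmult has_real_derivative_powr_times_one_minus_powr)
       (simp_all add: exponent)
  moreover have "q * (1 / q * ?v * ?w) + 1 / a * ((1 / q * (1 - y) - a * y) * ?v * ?w) =
      (1 / a + q) * (1 / q * ?v * ((1 - y) * ?w))"
    using q a(2) by (simp add: field_simps)
  ultimately show "((\<lambda>x. q * arcsin_pq p q (x powr (1 / q))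
          + 1 / a * (x powr (1 / q) * (1 - x) powr a))
          has_real_derivative (1 / a + q) * (1 / q * ?v * ((1 - y) * ?w))) (at y)"
    by simp
next
  show "continuous_on {0..x}
          (\<lambda>x. (1 / a + q) * (x powr (1 / q) * hypergeo_2F1 (1 / q) (- a) (1 + 1 / q) x))"
    using q x by (intro continuous_on_mult[OF continuous_on_const]
        continuous_on_powr_times_hypergeo_2F1) auto
  show "continuous_on {0..x}
          (\<lambda>x. q * arcsin_pq p q (x powr (1 / q)) + 1 / a * (x powr (1 / q) * (1 - x) powr a))"
    using q x by (intro continuous_on_add continuous_on_mult[OF continuous_on_const]
        continuous_on_arcsin_pq_powr continuous_on_powr_times_one_minus_powr) auto
qed simp

text \<open>
  Here the difference cancels the constant term of the polynomial and leaves a multiple of \<open>x\<close>,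
  which raises the exponent \<open>1/q - 1\<close> of \<open>x\<close> to the \<open>1/q\<close> required by the parameter \<open>1 + 1/q\<close>.
\<close>

lemma hypergeo_2F1_arcsin_pq_second:
  fixes p q x a :: real
  assumes a: "a = 1 - 1 / p" "a > 0" and q: "q > 0" and x: "0 < x" "x < 1"
  shows "(1 / a + q) * (x powr (1 + 1 / q) * hypergeo_2F1 (1 + 1 / q) (1 / p) (1 + (1 + 1 / q)) x) =
         (q + 1) / a * (arcsin_pq p q (x powr (1 / q)) - x powr (1 / q) * (1 - x) powr a)"
proof (rule eq_of_same_derivative_real[OF x(1)])
  have s: "1 + 1 / q > 0"
    using q by (simp add: add_pos_pos)
  fix y assume "0 < y" "y < x"
  with x have y: "0 < y" "y < 1"
    by auto
  let ?v = "y powr (1 / q - 1)" and ?w = "(1 - y) powr (a - 1)"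
  have v: "y powr (1 / q) = y * ?v"
    using y by (simp add: powr_diff)
  have exponent: "- 1 / p = a - 1" "- (1 / p) = a - 1"
    using a by simp_all
  show "((\<lambda>x. (1 / a + q)
            * (x powr (1 + 1 / q) * hypergeo_2F1 (1 + 1 / q) (1 / p) (1 + (1 + 1 / q)) x))
          has_real_derivative (1 / a + q) * ((1 + 1 / q) * (y * ?v) * ?w)) (at y)"
    using has_real_derivative_powr_times_hypergeo_2F1[of "1 + 1 / q" y "1 / p", OF s y]
    by (intro DERIV_cmult) (simp only: exponent add_diff_cancel_left' v)
  have "((\<lambda>x. (q + 1) / a * (arcsin_pq p q (x powr (1 / q)) - x powr (1 / q) * (1 - x) powr a))
          has_real_derivative
          (q + 1) / a * (1 / q * ?v * ?w - (1 / q * (1 - y) - a * y) * ?v * ?w)) (at y)"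
    using has_real_derivative_arcsin_pq_powr[of q y p] q y
    by (intro DERIV_diff DERIV_cmult has_real_derivative_powr_times_one_minus_powr)
       (simp_all add: exponent)
  moreover have "(q + 1) / a * (1 / q * ?v * ?w - (1 / q * (1 - y) - a * y) * ?v * ?w) =
      (1 / a + q) * ((1 + 1 / q) * (y * ?v) * ?w)"
    using q a(2) by (simp add: field_simps)
  ultimately show "((\<lambda>x. (q + 1) / a
            * (arcsin_pq p q (x powr (1 / q)) - x powr (1 / q) * (1 - x) powr a))
          has_real_derivative (1 / a + q) * ((1 + 1 / q) * (y * ?v) * ?w)) (at y)"
    by simp
next
  show "continuous_on {0..x} (\<lambda>x. (1 / a + q)
          * (x powr (1 + 1 / q) * hypergeo_2F1 (1 + 1 / q) (1 / p) (1 + (1 + 1 / q)) x))"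
    using q x by (intro continuous_on_mult[OF continuous_on_const]
        continuous_on_powr_times_hypergeo_2F1 add_pos_pos) auto
  show "continuous_on {0..x}
          (\<lambda>x. (q + 1) / a * (arcsin_pq p q (x powr (1 / q)) - x powr (1 / q) * (1 - x) powr a))"
    using q x by (intro continuous_on_mult[OF continuous_on_const] continuous_on_diff
        continuous_on_arcsin_pq_powr continuous_on_powr_times_one_minus_powr) auto
qed simp

theorem theorem1p2:
  fixes p q x :: real
  assumes "p > 1" and "q > 1" and "0 < x" and "x < 1"
  shows "hypergeo_2F1 (1 / q) (1 / p - 1) (1 + 1 / q) x =
           (q * arcsin_pq p q (x powr (1 / q))
              + conj_exponent p * x powr (1 / q) * (1 - x) powr (1 / conj_exponent p))
           / ((conj_exponent p + q) * x powr (1 / q))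
         \<and> hypergeo_2F1 (1 + 1 / q) (1 / p) (2 + 1 / q) x =
           conj_exponent p * (q + 1)
             * (arcsin_pq p q (x powr (1 / q))
                  - x powr (1 / q) * (1 - x) powr (1 / conj_exponent p))
           / ((conj_exponent p + q) * x powr (1 + 1 / q))"
proof -
  define a where "a = 1 - 1 / p"
  have a: "a = 1 - 1 / p" "a > 0" "conj_exponent p = 1 / a"
    using assms(1) by (auto simp: a_def conj_exponent_def field_simps)
  have params: "- a = 1 / p - 1" "1 + (1 + 1 / q) = 2 + 1 / q"
    by (simp_all add: a_def)
  have nonzero: "(1 / a + q) * x powr s \<noteq> 0" for s
  proof -
    have "1 / a + q > 0"
      using a(2) assms(2) by (intro add_pos_pos) auto
    then show ?thesis
      using assms(3) by simp
  qed
  have q: "q > 0"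
    using assms(2) by simp
  show ?thesis
    unfolding a(3) nonzero_eq_divide_eq[OF nonzero]
    using hypergeo_2F1_arcsin_pq_first[OF a(1,2) q assms(3,4), unfolded params]
      hypergeo_2F1_arcsin_pq_second[OF a(1,2) q assms(3,4), unfolded params]
    by (simp add: mult_ac)
qed

end
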